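(* For real $x\ge 2$ let $n'(x)$ be the positive integer with $\#(n'(x))\le x<\#(n'(x)+1)$, let $r'(x)=\frac{x-\#(n'(x))}{\#(n'(x)+1)-\#(n'(x))}$, and let $$y(x)=p_{n'(x)}\left(1+\left(\frac{p_{n'(x)+1}}{p_{n'(x)}}-1\right)r'(x)\right).$$ Let $f(x)=\prod_{i=1}^{n'(x)}\frac{p_i}{p_i-1}$ and $g^{\circ}(x)=e^{\gamma}\log(y(x))$, where $\gamma$ is Euler's constant. Then $\lim_{x\to\infty}f(x)/g^{\circ}(x)=1$.
   Context: $p_n$ denotes the $n$-th prime number; $\#(n)=\prod_{i=1}^{n}p_i$ is the $n$-th primorial; $\log$ is the natural logarithm. *)

theory Defs
  imports "HOL-Analysis.Analysis" "HOL-Computational_Algebra.Primes"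
begin

text \<open>
  Primes are indexed from 1, so the first prime is \<open>nth_prime 1 = 2\<close>; \<open>enumerate\<close> counts from 0.
  The value at index 0 is irrelevant.
\<close>
definition nth_prime :: "nat \<Rightarrow> nat" where
  "nth_prime n = enumerate {p. prime p} (n - 1)"

definition primorial :: "nat \<Rightarrow> nat" where
  "primorial n = (\<Prod>i=1..n. nth_prime i)"

text \<open>Well defined for \<open>x \<ge> 2\<close> by \<open>ex1_primorial_index\<close> below.\<close>
definition n_idx :: "real \<Rightarrow> nat" where
  "n_idx x = (THE n. n \<ge> 1 \<and> real (primorial n) \<le> x \<and> x < real (primorial (n + 1)))"

definition r_frac :: "real \<Rightarrow> real" where
  "r_frac x = (x - real (primorial (n_idx x))) /
          (real (primorial (n_idx x + 1)) - real (primorial (n_idx x)))"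

definition y_interp :: "real \<Rightarrow> real" where
  "y_interp x = real (nth_prime (n_idx x)) *
         (1 + (real (nth_prime (n_idx x + 1)) / real (nth_prime (n_idx x)) - 1) * r_frac x)"

definition f_prod :: "real \<Rightarrow> real" where
  "f_prod x = (\<Prod>i=1..n_idx x. real (nth_prime i) / (real (nth_prime i) - 1))"

definition g_circ :: "real \<Rightarrow> real" where
  "g_circ x = exp euler_mascheroni * ln (y_interp x)"

lemma prime_nth_prime: "prime (nth_prime n)"
  using enumerate_in_set[OF primes_infinite, of "n - 1"] by (simp add: nth_prime_def)

lemma nth_prime_1: "nth_prime 1 = 2"
  unfolding nth_prime_def
  by (auto simp: enumerate_0 intro!: Least_equality dest: prime_ge_2_nat)

lemma primorial_1: "primorial 1 = 2"
  using nth_prime_1 by (simp add: primorial_def)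

lemma primorial_pos: "primorial n > 0"
  unfolding primorial_def by (intro prod_pos ballI prime_gt_0_nat prime_nth_prime)

lemma primorial_Suc: "primorial (Suc n) = primorial n * nth_prime (Suc n)"
  by (simp add: primorial_def)

lemma strict_mono_primorial: "strict_mono primorial"
  unfolding strict_mono_Suc_iff
  using primorial_pos prime_gt_1_nat[OF prime_nth_prime] by (simp add: primorial_Suc)

lemma ex1_primorial_index:
  fixes x :: real
  assumes "x \<ge> 2"
  shows "\<exists>!n. n \<ge> 1 \<and> real (primorial n) \<le> x \<and> x < real (primorial (n + 1))"
proof -
  define A where "A = {n. real (primorial n) \<le> x}"
  have "n \<le> nat \<lfloor>x\<rfloor>" if "n \<in> A" for n
    using that strict_mono_imp_increasing[OF strict_mono_primorial, of n]
    by (simp add: A_def le_nat_floor)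
  then have fin: "finite A"
    by (meson finite_nat_set_iff_bounded_le)
  have one: "1 \<in> A"
    using assms primorial_1 by (simp add: A_def)
  have "Max A \<in> A"
    using fin one by (intro Max_in) auto
  moreover have "Max A \<ge> 1"
    using fin one by simp
  moreover have "Max A + 1 \<notin> A"
    using Max_ge[OF fin, of "Max A + 1"] by auto
  ultimately have ex: "Max A \<ge> 1 \<and> real (primorial (Max A)) \<le> x \<and> x < real (primorial (Max A + 1))"
    by (simp add: A_def)
  have le: "m \<le> n" if "real (primorial m) \<le> x" "x < real (primorial (n + 1))" for m n
  proof -
    have "primorial m < primorial (n + 1)"
      using that by linarith
    then show ?thesis
      using strict_mono_less[OF strict_mono_primorial] by simp
  qed
  show ?thesis
    using ex le by (intro ex1I[of _ "Max A"]) (auto intro: antisym)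
qed

end

theory Submission
  imports Defs "HOL-Real_Asymp.Real_Asymp"
begin

text \<open>
  With \<open>n = n_idx x\<close>, the value \<open>y_interp x\<close> lies between the \<open>n\<close>-th and the \<open>(n + 1)\<close>-st prime, so
  the claim is Mertens' third theorem
  \<open>(\<Prod>p | prime p \<and> p \<le> N. p / (p - 1)) \<sim> exp euler_mascheroni * ln N\<close>, used at both primes.

  Comparing the prime factorization of \<open>N!\<close> with \<open>ln N! = N * ln N + O(N)\<close> shows that the sum of
  \<open>ln p / p\<close> over \<open>p \<le> N\<close> is \<open>ln N + O(1)\<close>, and Dirichlet's test turns this into convergence of the
  sum of \<open>1 / p\<close> minus \<open>ln (ln N)\<close> to some \<open>B\<close>. By Abel's limit theorem the prime zeta function at
  \<open>1 + \<delta>\<close> is then \<open>- ln \<delta> + B - euler_mascheroni + o(1)\<close> as \<open>\<delta>\<close> tends to 0. The Euler product and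
  \<open>zeta (1 + \<delta>) \<sim> 1 / \<delta>\<close> show that adding the terms \<open>- ln (1 - 1 / p) - 1 / p\<close> leaves exactly
  \<open>- ln \<delta> + o(1)\<close>, so \<open>B\<close> plus the sum of these terms is \<open>euler_mascheroni\<close>.
\<close>

section \<open>Chebyshev's bound and Mertens' first theorem\<close>

lemma multiplicity_fact_rec:
  fixes p :: nat
  assumes "prime p"
  shows "multiplicity p (fact n) = n div p + multiplicity p (fact (n div p))"
proof (induction n)
  case (Suc n)
  have multiplicity_mult: "multiplicity p (m * k) = multiplicity p m + multiplicity p k"
    if "m > 0" "k > 0" for m k
    using assms that by (intro prime_elem_multiplicity_mult_distrib) auto
  have multiplicity_fact_Suc:
    "multiplicity p (fact (Suc n)) = multiplicity p (Suc n) + multiplicity p (fact n)"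
    using multiplicity_mult[of "Suc n" "fact n"] by (simp del: mult_Suc)
  show ?case
  proof (cases "p dvd Suc n")
    case True
    then obtain k where Suc_n_eq: "Suc n = p * k" by blast
    then have "Suc n div p = k" using prime_gt_0_nat[OF assms] by simp
    moreover have "Suc n div p = Suc (n div p)"
      using True by (simp add: div_Suc dvd_eq_mod_eq_0)
    ultimately have "k > 0" "n div p = k - 1" by simp_all
    have "multiplicity p (Suc n) = Suc (multiplicity p k)"
      using assms \<open>k > 0\<close> prime_gt_0_nat by (simp only: Suc_n_eq multiplicity_mult) simp
    moreover have "multiplicity p (fact k) = multiplicity p k + multiplicity p (fact (k - 1))"
      using multiplicity_mult[of k "fact (k - 1)"] \<open>k > 0\<close> by (simp add: fact_reduce)
    ultimately show ?thesis
      using multiplicity_fact_Suc Suc.IH \<open>k > 0\<close> \<open>n div p = k - 1\<close> \<open>Suc n div p = k\<close> by simp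
  next
    case False
    then have "Suc n div p = n div p" by (simp add: div_Suc dvd_eq_mod_eq_0)
    with multiplicity_fact_Suc Suc.IH False show ?thesis by (simp add: not_dvd_imp_multiplicity_0)
  qed
qed simp

lemma multiplicity_fact_le:
  fixes p :: nat
  assumes "prime p"
  shows "(p - 1) * multiplicity p (fact n) \<le> n"
proof (induction n rule: less_induct)
  case (less n)
  show ?case
  proof (cases "n = 0")
    case False
    have "p > 1" using assms by (rule prime_gt_1_nat)
    have "(p - 1) * multiplicity p (fact n) =
        (p - 1) * (n div p) + (p - 1) * multiplicity p (fact (n div p))"
      by (subst multiplicity_fact_rec[OF assms]) (rule distrib_left)
    also have "\<dots> \<le> (p - 1) * (n div p) + n div p"
      using less.IH[of "n div p"] False \<open>p > 1\<close> by simp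
    also have "\<dots> = p * (n div p)"
      using \<open>p > 1\<close> by (cases p) simp_all
    also have "\<dots> \<le> n" by simp
    finally show ?thesis .
  qed simp
qed

lemma ln_nat_eq_sum_prime_factors:
  assumes "n > 0"
  shows "ln (real n) = (\<Sum>p\<in>prime_factors n. real (multiplicity p n) * ln (real p))"
proof -
  have "real n = (\<Prod>p\<in>prime_factors n. real p ^ multiplicity p n)"
    by (subst prime_factorization_nat[OF assms]) simp
  also have "ln \<dots> = (\<Sum>p\<in>prime_factors n. ln (real p ^ multiplicity p n))"
    by (rule ln_prod) (auto simp: prime_factors_gt_0_nat)
  finally show ?thesis by (simp add: ln_realpow prime_factors_gt_0_nat)
qed

lemma ln_fact_eq_sum_primes:
  "ln (fact n) = (\<Sum>p | prime p \<and> p \<le> n. real (multiplicity p (fact n)) * ln (real p))"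
proof -
  have "prime_factors (fact n) = {p. prime p \<and> p \<le> n}"
    by (auto simp: prime_factors_dvd prime_dvd_fact_iff)
  then show ?thesis
    using ln_nat_eq_sum_prime_factors[of "fact n"] by simp
qed

lemma prod_primes_dvd:
  fixes n :: nat
  assumes "finite P" "\<And>p. p \<in> P \<Longrightarrow> prime p" "\<And>p. p \<in> P \<Longrightarrow> p dvd n"
  shows "\<Prod>P dvd n"
  using assms
proof (induction P)
  case (insert p P)
  have "coprime p (\<Prod>P)"
    using insert by (intro prod_coprime_right primes_coprime) auto
  with insert show ?case by (simp add: divides_mult)
qed simp

lemma central_binomial_odd_le: "(2 * m + 1) choose m \<le> 4 ^ m"
proof -
  have "2 * ((2 * m + 1) choose m) = (\<Sum>k\<in>{m, Suc m}. (2 * m + 1) choose k)"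
    using central_binomial_odd[of "2 * m + 1"] by simp
  also have "\<dots> \<le> (\<Sum>k\<le>2 * m + 1. (2 * m + 1) choose k)"
    by (intro sum_mono2) auto
  also have "\<dots> = 2 * 4 ^ m"
    by (simp only: choose_row_sum) (simp add: power_mult)
  finally show ?thesis by simp
qed

lemma prod_primes_between_le: "\<Prod>{p. prime p \<and> m + 1 < p \<and> p \<le> 2 * m + 1} \<le> (4 :: nat) ^ m"
proof -
  let ?n = "2 * m + 1"
  have "p dvd ?n choose m" if p: "prime p" "m + 1 < p" "p \<le> ?n" for p
  proof -
    have "p dvd fact m * fact (?n - m) * (?n choose m)"
      using p by (subst binomial_fact_lemma) (auto simp: prime_dvd_fact_iff simp del: fact_Suc)
    moreover have "\<not> p dvd fact m * fact (?n - m)"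
      using p by (auto simp: prime_dvd_fact_iff prime_dvd_mult_iff simp del: fact_Suc)
    ultimately show ?thesis using p by (simp add: prime_dvd_mult_iff)
  qed
  then have "\<Prod>{p. prime p \<and> m + 1 < p \<and> p \<le> ?n} dvd ?n choose m"
    by (intro prod_primes_dvd) auto
  then have "\<Prod>{p. prime p \<and> m + 1 < p \<and> p \<le> ?n} \<le> ?n choose m"
    by (rule dvd_imp_le) simp
  also have "\<dots> \<le> 4 ^ m" by (rule central_binomial_odd_le)
  finally show ?thesis .
qed

lemma prod_primes_le_four_power: "\<Prod>{p. prime p \<and> p \<le> n} \<le> (4 :: nat) ^ n"
proof (induction n rule: less_induct)
  case (less n)
  consider (le_1) "n \<le> 1" | (eq_2) "n = 2" | (even) "n > 2" "even n"
    | (odd) m where "n = 2 * m + 1" "m > 0"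
    by (cases "n \<le> 1"; cases "n = 2"; cases "even n") (auto elim!: oddE)
  then show ?case
  proof cases
    case le_1
    then have "{p. prime p \<and> p \<le> n} = {}" by (auto dest: prime_ge_2_nat)
    then show ?thesis by (simp only:) simp
  next
    case eq_2
    then have "{p. prime p \<and> p \<le> n} = {2}" by (auto dest: prime_ge_2_nat)
    with eq_2 show ?thesis by simp
  next
    case even
    then have "\<not> prime n" using prime_odd_nat by blast
    then have "{p. prime p \<and> p \<le> n} = {p. prime p \<and> p \<le> n - 1}"
      by (auto simp: le_less)
    with less.IH[of "n - 1"] even show ?thesis
      by (auto intro: order_trans[OF _ power_increasing])
  next
    case odd
    let ?small = "{p. prime p \<and> p \<le> m + 1}" and ?large = "{p. prime p \<and> m + 1 < p \<and> p \<le> n}"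
    have "{p. prime p \<and> p \<le> n} = ?small \<union> ?large"
      using odd by auto
    then have "\<Prod>{p. prime p \<and> p \<le> n} = \<Prod>?small * \<Prod>?large"
      by (simp only:) (rule prod.union_disjoint; auto)
    also have "\<dots> \<le> 4 ^ (m + 1) * 4 ^ m"
      using less.IH[of "m + 1"] prod_primes_between_le[of m] odd by (intro mult_le_mono) auto
    also have "\<dots> = 4 ^ n"
      using odd by (simp add: mult_2 power_add)
    finally show ?thesis .
  qed
qed

lemma sum_ln_primes_le: "(\<Sum>p | prime p \<and> p \<le> n. ln (real p)) \<le> real n * ln 4"
proof -
  have "real (\<Prod>{p. prime p \<and> p \<le> n}) \<le> real (4 ^ n)"
    using prod_primes_le_four_power[of n] by (rule of_nat_mono)
  then have "ln (\<Prod>p | prime p \<and> p \<le> n. real p) \<le> ln (4 ^ n)"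
    by (intro ln_mono prod_pos) (auto simp: prime_gt_0_nat)
  then show ?thesis
    by (subst (asm) ln_prod) (auto simp: ln_realpow prime_gt_0_nat)
qed

lemma ln_fact_bounds:
  "real n * ln (real n) - real n \<le> ln (fact n)" "ln (fact n) \<le> real n * ln (real n)"
proof -
  have "(\<Sum>k\<in>{n}. inverse (fact k) * real n ^ k) \<le> exp (real n)"
    unfolding exp_def scaleR_conv_of_real of_real_inverse of_real_fact
    by (rule sum_le_suminf[OF summable_exp]) auto
  then have "real n ^ n \<le> exp (real n) * fact n"
    by (simp add: field_simps)
  then have "ln (real n ^ n) \<le> ln (exp (real n) * fact n)"
    by (cases "n = 0") (auto intro!: ln_mono)
  then show "real n * ln (real n) - real n \<le> ln (fact n)"
    by (cases "n = 0") (auto simp: ln_mult ln_realpow)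
  have "(fact n :: real) \<le> real n ^ n"
    using fact_le_power[of n, where ?'a = real] by simp
  then have "ln (fact n :: real) \<le> ln (real n ^ n)"
    by (intro ln_mono) auto
  then show "ln (fact n) \<le> real n * ln (real n)"
    by (cases "n = 0") (auto simp: ln_realpow)
qed

lemma summable_ln_div_n_pred_n: "summable (\<lambda>n. ln (real n) / (real n * (real n - 1)))"
proof (rule summable_comparison_test_bigo)
  show "summable (\<lambda>n. norm (real n powr (-3/2)))"
    by (simp add: summable_real_powr_iff)
  show "(\<lambda>n. ln (real n) / (real n * (real n - 1))) \<in> O(\<lambda>n. real n powr (-3/2))"
    by real_asymp
qed

lemma mertens_first_lower:
  assumes "N > 0"
  shows "ln (real N) - 1 - (\<Sum>n. ln (real n) / (real n * (real n - 1))) \<le>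
    (\<Sum>p | prime p \<and> p \<le> N. ln (real p) / real p)"
proof -
  let ?g = "\<lambda>n. ln (real n) / (real n * (real n - 1))"
  have nonneg: "?g n \<ge> 0" for n
    by (cases "n = 0") auto
  have term_le:
    "real (multiplicity p (fact N)) * ln (real p) \<le> real N * (ln (real p) / real p + ?g p)"
    if "prime p" for p
  proof -
    have "real p > 1" using prime_gt_1_nat[OF that] by simp
    have "real ((p - 1) * multiplicity p (fact N)) \<le> real N"
      using multiplicity_fact_le[OF that] by (rule of_nat_mono)
    then have "real (multiplicity p (fact N)) \<le> real N / (real p - 1)"
      using \<open>real p > 1\<close> by (simp add: of_nat_diff field_simps)
    then have "real (multiplicity p (fact N)) * ln (real p) \<le> real N / (real p - 1) * ln (real p)"
      using \<open>real p > 1\<close> by (intro mult_right_mono) auto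
    also have "\<dots> = real N * (ln (real p) / real p + ?g p)"
      using \<open>real p > 1\<close> by (simp add: divide_simps) (simp add: algebra_simps)
    finally show ?thesis .
  qed
  have "real N * (ln (real N) - 1) \<le> ln (fact N)"
    using ln_fact_bounds(1)[of N] by (simp add: algebra_simps)
  also have "\<dots> \<le> (\<Sum>p | prime p \<and> p \<le> N. real N * (ln (real p) / real p + ?g p))"
    unfolding ln_fact_eq_sum_primes by (intro sum_mono term_le) auto
  also have "\<dots> = real N * ((\<Sum>p | prime p \<and> p \<le> N. ln (real p) / real p) +
      (\<Sum>p | prime p \<and> p \<le> N. ?g p))"
    by (simp only: sum_distrib_left [symmetric] sum.distrib)
  finally have "ln (real N) - 1 \<le>
      (\<Sum>p | prime p \<and> p \<le> N. ln (real p) / real p) + (\<Sum>p | prime p \<and> p \<le> N. ?g p)"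
    using assms by simp
  also have "(\<Sum>p | prime p \<and> p \<le> N. ?g p) \<le> (\<Sum>n. ?g n)"
    by (intro sum_le_suminf summable_ln_div_n_pred_n nonneg) auto
  finally show ?thesis by simp
qed

lemma mertens_first_upper:
  assumes "N > 0"
  shows "(\<Sum>p | prime p \<and> p \<le> N. ln (real p) / real p) \<le> ln (real N) + ln 4"
proof -
  have term_le:
    "real N * (ln (real p) / real p) \<le> real (multiplicity p (fact N)) * ln (real p) + ln (real p)"
    if "prime p" for p
  proof -
    have "real N / real p \<le> real (N div p) + 1"
      using floor_divide_of_nat_eq[of N p, where ?'a = real] by linarith
    also have "real (N div p) \<le> real (multiplicity p (fact N))"
      using multiplicity_fact_rec[OF that, of N] by simp
    finally have "real N / real p * ln (real p) \<le>
        (real (multiplicity p (fact N)) + 1) * ln (real p)"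
      using prime_gt_0_nat[OF that] by (intro mult_right_mono) auto
    then show ?thesis by (simp add: algebra_simps)
  qed
  have "real N * (\<Sum>p | prime p \<and> p \<le> N. ln (real p) / real p) \<le>
      ln (fact N) + (\<Sum>p | prime p \<and> p \<le> N. ln (real p))"
    unfolding ln_fact_eq_sum_primes sum_distrib_left sum.distrib [symmetric]
    by (intro sum_mono term_le) auto
  also have "\<dots> \<le> real N * (ln (real N) + ln 4)"
    using ln_fact_bounds(2)[of N] sum_ln_primes_le[of N] by (simp add: algebra_simps)
  finally show ?thesis using assms by simp
qed

theorem mertens_first: "Bseq (\<lambda>N. (\<Sum>p | prime p \<and> p \<le> N. ln (real p) / real p) - ln (real N))"
proof (rule BfunI)
  let ?K = "\<Sum>n. ln (real n) / (real n * (real n - 1))"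
  have "ln 4 \<ge> (0::real)" by simp
  then have "norm ((\<Sum>p | prime p \<and> p \<le> N. ln (real p) / real p) - ln (real N)) \<le> 1 + \<bar>?K\<bar> + ln 4"
    if "N > 0" for N
    using mertens_first_lower[OF that] mertens_first_upper[OF that]
    unfolding real_norm_def by linarith
  then show "\<forall>\<^sub>F N in sequentially.
      norm ((\<Sum>p | prime p \<and> p \<le> N. ln (real p) / real p) - ln (real N)) \<le> 1 + \<bar>?K\<bar> + ln 4"
    by (rule eventually_mono[OF eventually_gt_at_top])
qed

section \<open>Mertens' second theorem\<close>

lemma summable_Dirichlet_test:
  fixes c :: "nat \<Rightarrow> 'a :: banach" and v :: "nat \<Rightarrow> real"
  assumes "decseq v" "v \<longlonglongrightarrow> 0" "Bseq (\<lambda>n. \<Sum>i\<le>n. c i)"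
  shows "summable (\<lambda>n. v n *\<^sub>R c n)"
proof -
  define C where "C = (\<lambda>n. \<Sum>i\<le>n. c i)"
  obtain B where norm_C_le: "\<And>n. norm (C n) \<le> B"
    using assms(3) unfolding C_def Bseq_def by blast
  have summation_by_parts:
    "(\<Sum>i\<le>n. v i *\<^sub>R c i) = v n *\<^sub>R C n + (\<Sum>i<n. (v i - v (Suc i)) *\<^sub>R C i)" for n
    by (induction n) (simp_all add: C_def algebra_simps)
  have "summable (\<lambda>i. (v i - v (Suc i)) *\<^sub>R C i)"
  proof (rule summable_comparison_test')
    show "norm ((v i - v (Suc i)) *\<^sub>R C i) \<le> (v i - v (Suc i)) * B" for i
      using norm_C_le[of i] \<open>decseq v\<close> by (auto simp: decseq_Suc_iff intro!: mult_left_mono)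
    show "summable (\<lambda>i. (v i - v (Suc i)) * B)"
      using telescope_summable'[OF \<open>v \<longlonglongrightarrow> 0\<close>] by (rule summable_mult2)
  qed
  then have "convergent (\<lambda>n. \<Sum>i<n. (v i - v (Suc i)) *\<^sub>R C i)"
    by (simp add: summable_iff_convergent)
  moreover have "(\<lambda>n. v n *\<^sub>R C n) \<longlonglongrightarrow> 0"
  proof (rule Lim_null_comparison)
    show "\<forall>\<^sub>F n in sequentially. norm (v n *\<^sub>R C n) \<le> \<bar>v n\<bar> * B"
      using norm_C_le by (intro always_eventually) (auto intro!: mult_left_mono)
    show "(\<lambda>n. \<bar>v n\<bar> * B) \<longlonglongrightarrow> 0"
      using \<open>v \<longlonglongrightarrow> 0\<close> by (intro tendsto_mult_left_zero tendsto_rabs_zero)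
  qed
  ultimately show ?thesis
    unfolding summable_iff_convergent' summation_by_parts
    by (intro convergent_add) (auto simp: convergent_def)
qed

lemma has_integral_inverse_x_ln_x:
  fixes b c :: real
  assumes "c > 1" "b \<ge> 0"
  shows "((\<lambda>x. 1 / ((x + c) * ln (x + c))) has_integral (ln (ln (b + c)) - ln (ln c))) {0..b}"
proof -
  have "((\<lambda>x. 1 / ((x + c) * ln (x + c))) has_integral (ln (ln (b + c)) - ln (ln (0 + c)))) {0..b}"
  proof (rule fundamental_theorem_of_calculus)
    fix x assume "x \<in> {0..b}"
    then have "((\<lambda>x. ln (ln (x + c))) has_real_derivative 1 / ((x + c) * ln (x + c)))
        (at x within {0..b})"
      using assms by (auto intro!: derivative_eq_intros simp: divide_simps)
    then show "((\<lambda>x. ln (ln (x + c))) has_vector_derivative 1 / ((x + c) * ln (x + c)))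
        (at x within {0..b})"
      by (simp add: has_real_derivative_iff_has_vector_derivative)
  qed fact
  then show ?thesis by simp
qed

text \<open>The terms with \<open>n \<le> 1\<close> are divisions by zero and vanish.\<close>
lemma convergent_sum_inverse_n_ln_n:
  "convergent (\<lambda>N. (\<Sum>n\<le>N. 1 / (real n * ln (real n))) - ln (ln (real N)))"
proof -
  define f where "f = (\<lambda>x::real. 1 / ((x + 2) * ln (x + 2)))"
  interpret antimono_fun_sum_integral_diff f
  proof
    show "f y \<le> f x" if "0 \<le> x" "x \<le> y" for x y
      unfolding f_def using that
      by (intro divide_left_mono mult_mono mult_pos_pos) auto
    show "f x \<ge> 0" if "x \<ge> 0" for x
      unfolding f_def using that by auto
    show "continuous_on {0..} f"
      unfolding f_def by (intro continuous_intros) auto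
  qed
  have integral_f: "integral {0..real N} f = ln (ln (real N + 2)) - ln (ln 2)" for N
    unfolding f_def by (intro integral_unique has_integral_inverse_x_ln_x) auto
  have sum_f: "(\<Sum>k\<le>N. f (real k)) = (\<Sum>n\<le>N + 2. 1 / (real n * ln (real n)))" for N
    by (induction N) (simp_all add: f_def numeral_2_eq_2 add_ac)
  have "sum_integral_diff_series =
      (\<lambda>N. (\<Sum>n\<le>N + 2. 1 / (real n * ln (real n))) - ln (ln (real (N + 2))) + ln (ln 2))"
    unfolding sum_integral_diff_series_def fun_eq_iff integral_f sum_f by simp
  with sum_integral_diff_series_convergent
  have "convergent (\<lambda>N. (\<Sum>n\<le>N + 2. 1 / (real n * ln (real n))) - ln (ln (real (N + 2))))"
    by (simp add: convergent_add_const_right_iff)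
  then show ?thesis
    by (rule convergent_ignore_initial_segment [THEN iffD1])
qed

lemma sum_primes_le_eq_sum_if:
  fixes g :: "nat \<Rightarrow> 'a :: comm_monoid_add"
  shows "(\<Sum>p | prime p \<and> p \<le> N. g p) = (\<Sum>n\<le>N. if prime n then g n else 0)"
  by (subst sum.inter_filter [symmetric]) (auto intro: sum.cong)

theorem mertens_second_convergent:
  "convergent (\<lambda>N. (\<Sum>p | prime p \<and> p \<le> N. 1 / real p) - ln (ln (real N)))"
proof -
  define c where "c = (\<lambda>n. (if prime n then ln (real n) / real n else 0) - 1 / real n)"
  define v where "v = (\<lambda>n. 1 / ln (max 2 (real n)))"
  have sum_inverse_eq_harm: "(\<Sum>n\<le>N. 1 / real n) = harm N" for N
    by (induction N) (simp_all add: harm_def inverse_eq_divide)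
  have "Bseq (\<lambda>N. ((\<Sum>p | prime p \<and> p \<le> N. ln (real p) / real p) - ln (real N)) -
      (harm N - ln (real N)))"
    using mertens_first convergent_imp_Bseq[OF euler_mascheroni_convergent]
    unfolding Bseq_eq_bounded by (rule bounded_minus_comp)
  then have "Bseq (\<lambda>N. \<Sum>n\<le>N. c n)"
    by (simp add: c_def sum_subtractf sum_primes_le_eq_sum_if sum_inverse_eq_harm)
  moreover have "decseq v"
    unfolding v_def decseq_def by (auto intro!: divide_left_mono mult_pos_pos)
  moreover have "v \<longlonglongrightarrow> 0"
    unfolding v_def by real_asymp
  ultimately have "summable (\<lambda>n. v n *\<^sub>R c n)"
    by (intro summable_Dirichlet_test)
  also have "summable (\<lambda>n. v n *\<^sub>R c n) \<longleftrightarrow>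
      summable (\<lambda>n. (if prime n then 1 / real n else 0) - 1 / (real n * ln (real n)))"
    using eventually_ge_at_top[of 2]
    by (intro summable_cong, eventually_elim) (auto simp: v_def c_def field_simps)
  finally have "convergent (\<lambda>N.
      (\<Sum>n\<le>N. (if prime n then 1 / real n else 0) - 1 / (real n * ln (real n))) +
      ((\<Sum>n\<le>N. 1 / (real n * ln (real n))) - ln (ln (real N))))"
    unfolding summable_iff_convergent' by (intro convergent_add convergent_sum_inverse_n_ln_n)
  then show ?thesis
    by (simp add: sum_subtractf sum_primes_le_eq_sum_if)
qed

section \<open>Abelian theorems\<close>

lemma summable_power_scaleR:
  fixes e :: "nat \<Rightarrow> 'a :: banach" and r :: real
  assumes "Bseq e" "\<bar>r\<bar> < 1"
  shows "summable (\<lambda>n. r ^ n *\<^sub>R e n)"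
proof -
  obtain K where "\<And>n. norm (e n) \<le> K"
    using \<open>Bseq e\<close> unfolding Bseq_def by blast
  then have "norm (r ^ n *\<^sub>R e n) \<le> \<bar>r\<bar> ^ n * K" for n
    by (auto simp: power_abs intro!: mult_left_mono)
  moreover have "summable (\<lambda>n. \<bar>r\<bar> ^ n * K)"
    using assms by (intro summable_mult2 summable_geometric) auto
  ultimately show ?thesis by (rule summable_comparison_test'[rotated])
qed

lemma norm_abel_mean_le:
  fixes e :: "nat \<Rightarrow> 'a :: banach" and r :: real
  assumes r: "0 \<le> r" "r < 1" and tail: "\<And>n. n \<ge> K \<Longrightarrow> norm (e n) \<le> \<epsilon>"
  shows "norm ((1 - r) *\<^sub>R (\<Sum>n. r ^ n *\<^sub>R e n)) \<le> (1 - r) * (\<Sum>n<K. norm (e n)) + \<epsilon>"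
proof -
  have "\<epsilon> \<ge> 0"
    using tail[of K] norm_ge_zero order_trans by blast
  define B where "B = (\<Sum>n<K. norm (e n))"
  define w where "w = (\<lambda>n. (if n < K then norm (e n) else 0) + \<epsilon> * r ^ n)"
  have w_sums: "w sums (B + \<epsilon> * (1 / (1 - r)))"
    unfolding w_def B_def using r
    by (intro sums_add sums_mult geometric_sums sums_If_finite_set[of "{..<K}", simplified]) auto
  have "norm (r ^ n *\<^sub>R e n) \<le> w n" for n
  proof (cases "n < K")
    case True
    have "r ^ n * norm (e n) \<le> 1 * norm (e n)"
      using r by (intro mult_right_mono power_le_one) auto
    then show ?thesis
      using True r \<open>\<epsilon> \<ge> 0\<close> by (simp add: w_def add_increasing2)
  next
    case False
    then have "r ^ n * norm (e n) \<le> r ^ n * \<epsilon>"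
      using r tail[of n] by (intro mult_left_mono) auto
    with False show ?thesis
      using r by (simp add: w_def mult.commute)
  qed
  then have "norm (\<Sum>n. r ^ n *\<^sub>R e n) \<le> suminf w"
    using w_sums by (intro norm_suminf_le) (auto simp: sums_iff)
  also have "\<dots> = B + \<epsilon> * (1 / (1 - r))"
    using w_sums by (simp add: sums_iff)
  finally have "(1 - r) * norm (\<Sum>n. r ^ n *\<^sub>R e n) \<le> (1 - r) * (B + \<epsilon> * (1 / (1 - r)))"
    using r by (intro mult_left_mono) auto
  also have "\<dots> = (1 - r) * B + \<epsilon>"
    using r by (simp add: field_simps)
  finally show ?thesis
    using r by (simp add: B_def)
qed

lemma abel_mean_tendsto_0:
  fixes e :: "nat \<Rightarrow> 'a :: banach"
  assumes "e \<longlonglongrightarrow> 0"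
  shows "((\<lambda>r. (1 - r) *\<^sub>R (\<Sum>n. r ^ n *\<^sub>R e n)) \<longlongrightarrow> 0) (at_left 1)"
proof (rule tendstoI)
  fix \<epsilon> :: real assume "\<epsilon> > 0"
  then obtain K where tail: "\<And>n. n \<ge> K \<Longrightarrow> norm (e n) \<le> \<epsilon> / 2"
    using LIMSEQ_D[OF assms, of "\<epsilon> / 2"] by (auto intro: less_imp_le)
  have "((\<lambda>r. (1 - r) * (\<Sum>n<K. norm (e n))) \<longlongrightarrow> (1 - 1) * (\<Sum>n<K. norm (e n))) (at_left 1)"
    by (intro tendsto_intros)
  then have "\<forall>\<^sub>F r in at_left 1. (1 - r) * (\<Sum>n<K. norm (e n)) < \<epsilon> / 2"
    using \<open>\<epsilon> > 0\<close> by (intro order_tendstoD(2)) auto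
  moreover have "\<forall>\<^sub>F r in at_left (1::real). r \<in> {0<..<1}"
    using eventually_at_left_real[of 0 "1::real"] by simp
  ultimately show "\<forall>\<^sub>F r in at_left 1. dist ((1 - r) *\<^sub>R (\<Sum>n. r ^ n *\<^sub>R e n)) 0 < \<epsilon>"
  proof eventually_elim
    case (elim r)
    with norm_abel_mean_le[of r K e "\<epsilon> / 2"] tail show ?case by simp
  qed
qed

theorem abel_limit_theorem:
  fixes d :: "nat \<Rightarrow> 'a :: banach"
  assumes "d sums L"
  shows "((\<lambda>r. \<Sum>n. r ^ n *\<^sub>R d n) \<longlongrightarrow> L) (at_left 1)"
proof -
  define e where "e = (\<lambda>n. (\<Sum>i\<le>n. d i) - L)"
  have "e \<longlonglongrightarrow> 0"
    using assms unfolding e_def sums_def_le by (simp add: LIM_zero)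
  then have "Bseq e" by (intro convergent_imp_Bseq) (auto simp: convergent_def)
  have "(\<Sum>n. r ^ n *\<^sub>R d n) = L + (1 - r) *\<^sub>R (\<Sum>n. r ^ n *\<^sub>R e n)" if "0 < r" "r < 1" for r
  proof -
    let ?E = "\<Sum>n. r ^ n *\<^sub>R e n"
    have E_sums: "(\<lambda>n. r ^ n *\<^sub>R e n) sums ?E"
      using \<open>Bseq e\<close> that by (intro summable_sums summable_power_scaleR) auto
    then have "(\<lambda>n. r ^ Suc n *\<^sub>R e (Suc n)) sums (?E - e 0)"
      by (subst sums_Suc_iff) simp
    moreover have "(\<lambda>n. r ^ Suc n *\<^sub>R e n) sums (r *\<^sub>R ?E)"
      using sums_scaleR_right[OF E_sums, of r] by simp
    ultimately have "(\<lambda>n. r ^ Suc n *\<^sub>R e (Suc n) - r ^ Suc n *\<^sub>R e n) sums (?E - e 0 - r *\<^sub>R ?E)"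
      by (rule sums_diff)
    then have "(\<lambda>n. r ^ Suc n *\<^sub>R d (Suc n)) sums (?E - e 0 - r *\<^sub>R ?E)"
      by (simp add: e_def flip: scaleR_diff_right)
    then have "(\<lambda>n. r ^ n *\<^sub>R d n) sums (?E - e 0 - r *\<^sub>R ?E + d 0)"
      by (subst (asm) sums_Suc_iff) simp
    then show ?thesis by (simp add: sums_iff e_def algebra_simps)
  qed
  then have "\<forall>\<^sub>F r in at_left 1. L + (1 - r) *\<^sub>R (\<Sum>n. r ^ n *\<^sub>R e n) = (\<Sum>n. r ^ n *\<^sub>R d n)"
    using eventually_at_left_real[of 0 "1::real"] by (auto elim!: eventually_mono)
  moreover have "((\<lambda>r. L + (1 - r) *\<^sub>R (\<Sum>n. r ^ n *\<^sub>R e n)) \<longlongrightarrow> L + 0) (at_left 1)"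
    by (intro tendsto_intros abel_mean_tendsto_0 \<open>e \<longlonglongrightarrow> 0\<close>)
  ultimately show ?thesis
    by (simp add: tendsto_cong)
qed

lemma sums_power_div_Suc:
  fixes r :: real
  assumes "0 < r" "r < 1"
  shows "(\<lambda>i. r ^ i / real (Suc i)) sums (- ln (1 - r) / r)"
proof -
  from sums_minus[OF Complex_Transcendental.ln_series'[of "-r"]]
  have "(\<lambda>k. r ^ k / real k) sums - ln (1 - r)" using assms by simp
  then have "(\<lambda>k. r ^ Suc k / real (Suc k)) sums - ln (1 - r)"
    by (subst sums_Suc_iff) simp
  from sums_divide[OF this, of r] show ?thesis
    using assms by simp
qed

lemma sums_minus_harmonic:
  fixes b :: "nat \<Rightarrow> real"
  assumes "(\<lambda>M. (\<Sum>i<M. b i) - ln (real M)) \<longlonglongrightarrow> C"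
  shows "(\<lambda>i. b i - 1 / real (Suc i)) sums (C - euler_mascheroni)"
proof -
  have "(\<Sum>i<M. 1 / real (Suc i)) = harm M" for M
    by (induction M) (auto simp: harm_Suc harm_expand inverse_eq_divide)
  then have "(\<lambda>M. (\<Sum>i<M. b i - 1 / real (Suc i))) =
      (\<lambda>M. ((\<Sum>i<M. b i) - ln (real M)) - (harm M - ln (real M)))"
    by (simp add: sum_subtractf)
  also have "\<dots> \<longlonglongrightarrow> C - euler_mascheroni"
    by (intro tendsto_diff assms euler_mascheroni_LIMSEQ)
  finally show ?thesis unfolding sums_def .
qed

lemma sums_power_minus_harmonic:
  fixes b :: "nat \<Rightarrow> real"
  assumes "(\<lambda>M. (\<Sum>i<M. b i) - ln (real M)) \<longlonglongrightarrow> C" and r: "0 < r" "r < 1"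
  shows "(\<lambda>i. r ^ i * b i) sums ((\<Sum>i. r ^ i * (b i - 1 / real (Suc i))) - ln (1 - r) / r)"
proof -
  have "Bseq (\<lambda>i. b i - 1 / real (Suc i))"
    using summable_LIMSEQ_zero[OF sums_summable[OF sums_minus_harmonic[OF assms(1)]]]
    by (intro convergent_imp_Bseq) (auto simp: convergent_def)
  then have "summable (\<lambda>i. r ^ i * (b i - 1 / real (Suc i)))"
    using summable_power_scaleR[of "\<lambda>i. b i - 1 / real (Suc i)" r] r by simp
  from sums_add[OF summable_sums[OF this] sums_power_div_Suc[OF r]] show ?thesis
    by (simp add: algebra_simps)
qed

lemma power_series_log_asymptotics:
  fixes b :: "nat \<Rightarrow> real"
  assumes "(\<lambda>M. (\<Sum>i<M. b i) - ln (real M)) \<longlonglongrightarrow> C"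
  shows "((\<lambda>r. (\<Sum>i. r ^ i * b i) + ln (1 - r)) \<longlongrightarrow> C - euler_mascheroni) (at_left 1)"
proof -
  let ?D = "\<lambda>r. \<Sum>i. r ^ i * (b i - 1 / real (Suc i))"
  have "((\<lambda>r. ?D r + (ln (1 - r) - ln (1 - r) / r)) \<longlongrightarrow> C - euler_mascheroni + 0) (at_left 1)"
  proof (rule tendsto_add)
    show "(?D \<longlongrightarrow> C - euler_mascheroni) (at_left 1)"
      using abel_limit_theorem[OF sums_minus_harmonic[OF assms]] by simp
    show "((\<lambda>r::real. ln (1 - r) - ln (1 - r) / r) \<longlongrightarrow> 0) (at_left 1)"
      by real_asymp
  qed
  moreover have "\<forall>\<^sub>F r in at_left 1.
      ?D r + (ln (1 - r) - ln (1 - r) / r) = (\<Sum>i. r ^ i * b i) + ln (1 - r)"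
    using eventually_at_left_real[of 0 "1::real"]
    by (auto elim!: eventually_mono
        simp: sums_unique[OF sums_power_minus_harmonic[OF assms], symmetric])
  ultimately show ?thesis
    unfolding add_0_right by (rule Lim_transform_eventually)
qed

text \<open>
  Cutting a Dirichlet series into the blocks \<open>exp i \<le> n < exp (i + 1)\<close> turns it into a power series
  in \<open>exp (-\<delta>)\<close>, up to a factor of \<open>exp \<delta>\<close> that is harmless because the series only grows like
  \<open>- ln \<delta>\<close>.
\<close>

definition exp_cut :: "nat \<Rightarrow> nat" where
  "exp_cut i = nat \<lceil>exp (real i)\<rceil> - 1"

lemma le_exp_cut_iff: "n \<le> exp_cut i \<longleftrightarrow> real n < exp (real i)"
proof -
  have "nat \<lceil>exp (real i)\<rceil> > 0" by simp
  then have "n \<le> exp_cut i \<longleftrightarrow> \<not> nat \<lceil>exp (real i)\<rceil> \<le> n"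
    unfolding exp_cut_def by linarith
  then show ?thesis by (simp add: nat_ceiling_le_eq not_le)
qed

lemma exp_cut_0 [simp]: "exp_cut 0 = 0"
  by (simp add: exp_cut_def)

lemma exp_cut_mono: "i \<le> j \<Longrightarrow> exp_cut i \<le> exp_cut j"
  unfolding exp_cut_def by (intro diff_le_mono nat_mono ceiling_mono) simp

lemma exp_cut_bounds: "real (exp_cut i) < exp (real i)" "exp (real i) \<le> real (exp_cut i) + 1"
  using le_exp_cut_iff[of "exp_cut i" i] le_exp_cut_iff[of "Suc (exp_cut i)" i] by auto

lemma index_le_exp_cut: "i \<le> exp_cut i"
  unfolding le_exp_cut_iff using exp_ge_add_one_self[of "real i"] by linarith

lemma filterlim_exp_cut: "filterlim exp_cut at_top sequentially"
  by (rule filterlim_at_top_mono[OF filterlim_ident]) (simp add: index_le_exp_cut)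

lemma ln_ln_exp_cut: "(\<lambda>M. ln (ln (real (exp_cut M))) - ln (real M)) \<longlonglongrightarrow> 0"
proof (rule tendsto_sandwich)
  show "(\<lambda>M. ln (ln (exp (real M) - 1)) - ln (real M)) \<longlonglongrightarrow> 0" by real_asymp
  have "\<forall>\<^sub>F M in sequentially. ln (ln (exp (real M) - 1)) \<le> ln (ln (real (exp_cut M))) \<and>
          ln (ln (real (exp_cut M))) \<le> ln (real M)"
    using eventually_ge_at_top[of 2]
  proof eventually_elim
    case (elim M)
    have "exp (real M) - 1 > 1"
      using elim exp_ge_add_one_self[of "real M"] by linarith
    moreover from this have "exp (real M) - 1 \<le> real (exp_cut M)" "real (exp_cut M) > 1"
      using exp_cut_bounds[of M] by linarith+
    moreover from this have "ln (real (exp_cut M)) \<le> real M"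
      using exp_cut_bounds(1)[of M] ln_mono[of "real (exp_cut M)" "exp (real M)"] by simp
    ultimately show ?case using elim by (intro conjI ln_mono) (auto intro!: ln_gt_zero)
  qed
  then show "\<forall>\<^sub>F M in sequentially.
      ln (ln (exp (real M) - 1)) - ln (real M) \<le> ln (ln (real (exp_cut M))) - ln (real M)"
    "\<forall>\<^sub>F M in sequentially. ln (ln (real (exp_cut M))) - ln (real M) \<le> 0"
    by (auto elim!: eventually_mono)
qed auto

definition log_block_sum :: "(nat \<Rightarrow> real) \<Rightarrow> nat \<Rightarrow> real" where
  "log_block_sum w i = (\<Sum>n\<in>{exp_cut i<..exp_cut (Suc i)}. w n)"

lemma sum_log_block_sum: "(\<Sum>i<M. log_block_sum w i) = (\<Sum>n=1..exp_cut M. w n)"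
proof (induction M)
  case (Suc M)
  have "{1..exp_cut (Suc M)} = {1..exp_cut M} \<union> {exp_cut M<..exp_cut (Suc M)}"
    using exp_cut_mono[of M "Suc M"] by auto
  then have "(\<Sum>n=1..exp_cut (Suc M). w n) = (\<Sum>n=1..exp_cut M. w n) + log_block_sum w M"
    unfolding log_block_sum_def by (simp only:) (rule sum.union_disjoint; auto)
  with Suc show ?case by simp
qed simp

lemma log_block_sum_powr_bounds:
  fixes w :: "nat \<Rightarrow> real" and \<delta> :: real
  assumes nonneg: "\<And>n. w n \<ge> 0" and "\<delta> > 0"
  shows "exp (-\<delta>) * (exp (-\<delta>) ^ i * log_block_sum w i) \<le> log_block_sum (\<lambda>n. w n * real n powr -\<delta>) i"
    and "log_block_sum (\<lambda>n. w n * real n powr -\<delta>) i \<le> exp (-\<delta>) ^ i * log_block_sum w i"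
proof -
  have powr_exp: "exp (real i) powr -\<delta> = exp (-\<delta>) ^ i" for i
    by (simp add: powr_def exp_of_nat_mult [symmetric] mult.commute)
  have "exp (-\<delta>) ^ Suc i \<le> real n powr -\<delta> \<and> real n powr -\<delta> \<le> exp (-\<delta>) ^ i"
    if "n \<in> {exp_cut i<..exp_cut (Suc i)}" for n
  proof -
    have "exp (real i) \<le> real n" "real n < exp (real (Suc i))" "n > 0"
      using that le_exp_cut_iff[of n i] le_exp_cut_iff[of n "Suc i"] by auto
    then show ?thesis
      unfolding powr_exp [symmetric] using assms by (auto intro!: powr_mono2')
  qed
  then show "exp (-\<delta>) * (exp (-\<delta>) ^ i * log_block_sum w i) \<le>
      log_block_sum (\<lambda>n. w n * real n powr -\<delta>) i"
    and "log_block_sum (\<lambda>n. w n * real n powr -\<delta>) i \<le> exp (-\<delta>) ^ i * log_block_sum w i"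
    unfolding log_block_sum_def sum_distrib_left mult.commute[of "w _"] mult.assoc [symmetric]
    by (intro sum_mono mult_right_mono nonneg; simp)+
qed

lemma dirichlet_series_block_bounds:
  fixes w :: "nat \<Rightarrow> real" and \<delta> :: real
  assumes nonneg: "\<And>n. w n \<ge> 0" and \<delta>_pos: "\<delta> > 0"
    and summable: "summable (\<lambda>i. exp (-\<delta>) ^ i * log_block_sum w i)"
  defines "P \<equiv> (\<Sum>i. exp (-\<delta>) ^ i * log_block_sum w i)"
  shows "exp (-\<delta>) * P \<le> (\<Sum>n. w n * real n powr -\<delta>)" "(\<Sum>n. w n * real n powr -\<delta>) \<le> P"
proof -
  define f where "f = (\<lambda>n. w n * real n powr -\<delta>)"
  note bounds = log_block_sum_powr_bounds[of w \<delta>, OF nonneg \<delta>_pos]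
  have f_nonneg: "f n \<ge> 0" for n using nonneg by (simp add: f_def)
  have P_sums: "(\<lambda>i. exp (-\<delta>) ^ i * log_block_sum w i) sums P"
    unfolding P_def using summable by (rule summable_sums)
  have sum_f: "(\<Sum>n\<le>N. f n) = (\<Sum>n=1..N. f n)" for N
    by (induction N) (simp_all add: f_def)
  have "summable f"
  proof (rule bounded_imp_summable[OF f_nonneg])
    fix N
    have "(\<Sum>n\<le>N. f n) \<le> (\<Sum>n=1..exp_cut N. f n)"
      unfolding sum_f using index_le_exp_cut[of N] f_nonneg by (intro sum_mono2) auto
    also have "\<dots> = (\<Sum>i<N. log_block_sum f i)" by (rule sum_log_block_sum [symmetric])
    also have "\<dots> \<le> (\<Sum>i<N. exp (-\<delta>) ^ i * log_block_sum w i)"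
      unfolding f_def by (intro sum_mono bounds)
    also have "\<dots> \<le> P"
      unfolding P_def using nonneg
      by (intro sum_le_suminf summable)
         (auto simp: log_block_sum_def intro!: mult_nonneg_nonneg sum_nonneg)
    finally show "(\<Sum>n\<le>N. f n) \<le> P" .
  qed
  then have "(\<lambda>N. \<Sum>n=1..N. f n) \<longlonglongrightarrow> suminf f"
    using summable_LIMSEQ' unfolding sum_f [symmetric] by blast
  from filterlim_compose[OF this filterlim_exp_cut]
  have "log_block_sum f sums suminf f"
    unfolding sums_def sum_log_block_sum .
  note f_sums = this [unfolded f_def]
  show "exp (-\<delta>) * P \<le> (\<Sum>n. w n * real n powr -\<delta>)"
    by (rule sums_le[OF _ sums_mult[OF P_sums] f_sums]) (rule bounds)
  show "(\<Sum>n. w n * real n powr -\<delta>) \<le> P"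
    by (rule sums_le[OF _ f_sums P_sums]) (rule bounds)
qed

theorem dirichlet_series_log_asymptotics:
  fixes w :: "nat \<Rightarrow> real"
  assumes nonneg: "\<And>n. w n \<ge> 0"
    and lim: "(\<lambda>N. (\<Sum>n=1..N. w n) - ln (ln (real N))) \<longlonglongrightarrow> C"
  shows "((\<lambda>\<delta>. (\<Sum>n. w n * real n powr -\<delta>) + ln \<delta>) \<longlongrightarrow> C - euler_mascheroni) (at_right 0)"
proof -
  define P where "P = (\<lambda>\<delta>. \<Sum>i. exp (-\<delta>) ^ i * log_block_sum w i)"
  have "(\<lambda>M. ((\<Sum>n=1..exp_cut M. w n) - ln (ln (real (exp_cut M)))) +
      (ln (ln (real (exp_cut M))) - ln (real M))) \<longlonglongrightarrow> C + 0"
    by (intro tendsto_add filterlim_compose[OF lim filterlim_exp_cut] ln_ln_exp_cut)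
  then have blocks: "(\<lambda>M. (\<Sum>i<M. log_block_sum w i) - ln (real M)) \<longlonglongrightarrow> C"
    by (simp add: sum_log_block_sum)
  have "filterlim (\<lambda>\<delta>::real. exp (-\<delta>)) (at_left 1) (at_right 0)"
    by real_asymp
  with power_series_log_asymptotics[OF blocks]
  have P_asymp: "((\<lambda>\<delta>. P \<delta> + ln (1 - exp (-\<delta>))) \<longlongrightarrow> C - euler_mascheroni) (at_right 0)"
    unfolding P_def by (rule filterlim_compose)
  have bounds: "exp (-\<delta>) * P \<delta> \<le> (\<Sum>n. w n * real n powr -\<delta>)" "(\<Sum>n. w n * real n powr -\<delta>) \<le> P \<delta>"
    if "\<delta> > 0" for \<delta>
    unfolding P_def using that
    by (auto intro!: dirichlet_series_block_bounds nonneg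
        sums_summable[OF sums_power_minus_harmonic[OF blocks]])
  show ?thesis
  proof (rule tendsto_sandwich)
    have "((\<lambda>\<delta>. exp (-\<delta>) * (P \<delta> + ln (1 - exp (-\<delta>))) + (ln \<delta> - exp (-\<delta>) * ln (1 - exp (-\<delta>))))
        \<longlongrightarrow> 1 * (C - euler_mascheroni) + 0) (at_right 0)"
      by (intro tendsto_add tendsto_mult P_asymp) real_asymp+
    then show "((\<lambda>\<delta>. exp (-\<delta>) * P \<delta> + ln \<delta>) \<longlongrightarrow> C - euler_mascheroni) (at_right 0)"
      by (simp add: algebra_simps)
    have "((\<lambda>\<delta>. (P \<delta> + ln (1 - exp (-\<delta>))) + (ln \<delta> - ln (1 - exp (-\<delta>))))
        \<longlongrightarrow> (C - euler_mascheroni) + 0) (at_right 0)"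
      by (intro tendsto_add P_asymp) real_asymp
    then show "((\<lambda>\<delta>. P \<delta> + ln \<delta>) \<longlongrightarrow> C - euler_mascheroni) (at_right 0)"
      by simp
  qed (use bounds in \<open>auto intro!: eventually_at_rightI[of 0 1]\<close>)
qed

section \<open>The Euler product\<close>

definition rough_numbers :: "nat set \<Rightarrow> nat set" where
  "rough_numbers P = {n. n > 0 \<and> (\<forall>p\<in>P. \<not> p dvd n)}"

text \<open>Multiplying by \<open>1 - f p\<close> strikes out the multiples of \<open>p\<close>.\<close>
lemma has_sum_euler_sieve:
  fixes f :: "nat \<Rightarrow> 'a :: real_normed_field"
  assumes mult: "\<And>m n. f (m * n) = f m * f n" and sum_f: "(f has_sum S) {0<..}"
    and "finite P" "\<And>p. p \<in> P \<Longrightarrow> prime p"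
  shows "(f has_sum (\<Prod>p\<in>P. 1 - f p) * S) (rough_numbers P)"
  using assms(3,4)
proof (induction P)
  case empty
  have "rough_numbers {} = {0<..}" by (auto simp: rough_numbers_def)
  with sum_f show ?case by simp
next
  case (insert p P)
  define A where "A = rough_numbers P"
  define T where "T = (\<Prod>q\<in>P. 1 - f q) * S"
  have prime_p: "prime p" using insert.prems by simp
  have sum_A: "(f has_sum T) A"
    unfolding A_def T_def using insert by simp
  have "inj_on ((*) p) A"
    using prime_gt_0_nat[OF prime_p] by (auto intro: inj_onI)
  then have multiples: "(f has_sum f p * T) ((*) p ` A)"
    using has_sum_cmult_right[OF sum_A, of "f p"] by (subst has_sum_reindex) (auto simp: o_def mult)
  have dvd_mult_iff: "q dvd p * m \<longleftrightarrow> q dvd m" if "q \<in> P" for q m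
    using that insert.hyps insert.prems prime_p primes_dvd_imp_eq[of q p]
    by (metis dvd_mult insertCI prime_dvd_mult_iff)
  then have "(*) p ` A \<subseteq> A"
    using prime_gt_0_nat[OF prime_p] by (auto simp: A_def rough_numbers_def)
  from has_sum_Diff[OF sum_A multiples this] have "(f has_sum (1 - f p) * T) (A - (*) p ` A)"
    by (simp add: algebra_simps)
  also have "A - (*) p ` A = rough_numbers (insert p P)"
    using dvd_mult_iff by (auto simp: A_def rough_numbers_def elim!: dvdE)
  also have "(1 - f p) * T = (\<Prod>q\<in>insert p P. 1 - f q) * S"
    using insert.hyps by (simp add: T_def mult.assoc)
  finally show ?case .
qed

lemma eventually_rough_numbers_iff:
  "\<forall>\<^sub>F N in sequentially. n \<in> rough_numbers {p. prime p \<and> p \<le> N} \<longleftrightarrow> n = 1"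
proof (cases "n \<le> 1")
  case True
  then show ?thesis
    by (intro always_eventually) (cases n; auto simp: rough_numbers_def)
next
  case False
  then obtain p where p: "prime p" "p dvd n"
    using prime_factor_nat[of n] by auto
  show ?thesis
    using eventually_ge_at_top[of p]
    by eventually_elim (use p False in \<open>auto simp: rough_numbers_def\<close>)
qed

lemma euler_sieve_tendsto:
  fixes f :: "nat \<Rightarrow> 'a :: {real_normed_field, banach}"
  assumes mult: "\<And>m n. f (m * n) = f m * f n" and "f 0 = 0"
    and summable: "summable (\<lambda>n. norm (f n))"
  shows "(\<lambda>N. (\<Prod>p | prime p \<and> p \<le> N. 1 - f p) * (\<Sum>n. f n)) \<longlonglongrightarrow> f 1"
proof -
  let ?rough = "\<lambda>N. rough_numbers {p. prime p \<and> p \<le> N}"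
  let ?g = "\<lambda>n N. if n \<in> ?rough N then f n else 0"
  have "(f has_sum (\<Sum>n. f n)) UNIV"
    by (intro norm_summable_imp_has_sum summable summable_sums summable_norm_cancel)
  then have "(f has_sum (\<Sum>n. f n)) {0<..}"
    using \<open>f 0 = 0\<close> by (subst has_sum_cong_neutral[of UNIV]) auto
  then have "(f has_sum (\<Prod>p | prime p \<and> p \<le> N. 1 - f p) * (\<Sum>n. f n)) (?rough N)" for N
    by (intro has_sum_euler_sieve mult) auto
  also have "(f has_sum S) (?rough N) \<longleftrightarrow> ((\<lambda>n. ?g n N) has_sum S) UNIV" for N S
    by (intro has_sum_cong_neutral) auto
  finally have sieved: "(\<Sum>n. ?g n N) = (\<Prod>p | prime p \<and> p \<le> N. 1 - f p) * (\<Sum>n. f n)" for N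
    by (intro sums_unique [symmetric] has_sum_imp_sums)
  have lim: "?g n \<longlonglongrightarrow> (if n = 1 then f 1 else 0)" for n
    by (rule tendsto_eventually[OF eventually_mono[OF eventually_rough_numbers_iff[of n]]]) simp
  have bound: "\<forall>\<^sub>F (n, N) in at_top \<times>\<^sub>F sequentially. norm (?g n N) \<le> norm (f n)"
    by (intro always_eventually) auto
  have "(\<lambda>N. \<Sum>n. ?g n N) \<longlonglongrightarrow> (\<Sum>n. if n = 1 then f 1 else 0)"
    using tannerys_theorem[OF lim bound summable] by simp
  also have "(\<Sum>n. if n = 1 then f 1 else 0) = f 1"
    using sums_single[of 1 f] by (simp add: sums_iff if_distrib cong: if_cong)
  finally show ?thesis unfolding sieved .
qed

definition real_zeta :: "real \<Rightarrow> real" where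
  "real_zeta s = (\<Sum>n. real n powr -s)"

lemma summable_real_zeta: "s > 1 \<Longrightarrow> summable (\<lambda>n. real n powr -s)"
  by (simp add: summable_real_powr_iff)

lemma real_zeta_pos:
  assumes "s > 1"
  shows "real_zeta s > 0"
  unfolding real_zeta_def by (rule suminf_pos2[OF summable_real_zeta[OF assms], of 1]) auto

lemma prime_powr_less_1: "prime p \<Longrightarrow> s > 0 \<Longrightarrow> real p powr -s < 1"
  by (auto dest: prime_gt_1_nat simp: powr_less_one)

lemma ln_real_zeta_sums:
  assumes "s > 1"
  shows "(\<lambda>n. if prime n then - ln (1 - real n powr -s) else 0) sums ln (real_zeta s)"
proof -
  define Q where "Q = (\<lambda>N. \<Prod>p | prime p \<and> p \<le> N. 1 - real p powr -s)"
  have factor_pos: "1 - real p powr -s > 0" if "prime p" for p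
    using prime_powr_less_1[OF that, of s] assms by simp
  have Q_pos: "Q N > 0" for N
    unfolding Q_def using factor_pos by (intro prod_pos) auto
  have "(\<lambda>N. Q N * real_zeta s) \<longlonglongrightarrow> real 1 powr -s"
    unfolding Q_def real_zeta_def
    by (rule euler_sieve_tendsto) (use assms in \<open>auto simp: powr_mult summable_real_zeta\<close>)
  then have "(\<lambda>N. ln (real_zeta s) - ln (Q N * real_zeta s)) \<longlonglongrightarrow> ln (real_zeta s) - ln 1"
    by (intro tendsto_intros) auto
  moreover have "ln (real_zeta s) - ln (Q N * real_zeta s) =
      (\<Sum>n\<le>N. if prime n then - ln (1 - real n powr -s) else 0)" for N
  proof -
    have "ln (real_zeta s) - ln (Q N * real_zeta s) = - ln (Q N)"
      using Q_pos[of N] real_zeta_pos[OF assms] by (simp add: ln_mult)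
    also have "\<dots> = - (\<Sum>p | prime p \<and> p \<le> N. ln (1 - real p powr -s))"
      unfolding Q_def by (subst ln_prod) (auto dest: factor_pos)
    also have "\<dots> = (\<Sum>p | prime p \<and> p \<le> N. - ln (1 - real p powr -s))"
      by (simp add: sum_negf)
    finally show ?thesis
      by (simp only: sum_primes_le_eq_sum_if)
  qed
  ultimately show ?thesis by (simp add: sums_def_le)
qed

lemma powr_neg_step_bounds:
  fixes \<delta> :: real
  assumes "\<delta> > 0" "n > 0"
  shows "real (Suc n) powr -(1 + \<delta>) \<le> (real n powr -\<delta> - real (Suc n) powr -\<delta>) / \<delta>"
    and "(real n powr -\<delta> - real (Suc n) powr -\<delta>) / \<delta> \<le> real n powr -(1 + \<delta>)"
proof -
  have exponent_eq: "- 1 - \<delta> = - \<delta> - 1" by simp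
  have "\<exists>z. real n < z \<and> z < real (Suc n) \<and>
      real (Suc n) powr -\<delta> - real n powr -\<delta> = (real (Suc n) - real n) * (-\<delta> * z powr -(1 + \<delta>))"
    using assms by (intro MVT2) (auto intro!: derivative_eq_intros simp: exponent_eq)
  then obtain z where z: "real n < z" "z < real (Suc n)"
      "(real n powr -\<delta> - real (Suc n) powr -\<delta>) / \<delta> = z powr -(1 + \<delta>)"
    using assms by (auto simp: field_simps)
  then show "real (Suc n) powr -(1 + \<delta>) \<le> (real n powr -\<delta> - real (Suc n) powr -\<delta>) / \<delta>"
    and "(real n powr -\<delta> - real (Suc n) powr -\<delta>) / \<delta> \<le> real n powr -(1 + \<delta>)"
    using assms by (auto intro!: powr_mono2')
qed

lemma real_zeta_bounds:
  assumes "\<delta> > 0"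
  shows "1 / \<delta> \<le> real_zeta (1 + \<delta>)" "real_zeta (1 + \<delta>) \<le> 1 + 1 / \<delta>"
proof -
  define u where "u = (\<lambda>n. real (Suc n) powr -\<delta>)"
  have "u \<longlonglongrightarrow> 0"
    unfolding u_def using assms by real_asymp
  from sums_divide[OF telescope_sums'[OF this], of \<delta>]
  have telescope: "(\<lambda>n. (u n - u (Suc n)) / \<delta>) sums (1 / \<delta>)"
    by (simp add: u_def)
  have "(\<lambda>n. real n powr -(1 + \<delta>)) sums real_zeta (1 + \<delta>)"
    unfolding real_zeta_def using assms by (intro summable_sums summable_real_zeta) auto
  then have sums_from_1: "(\<lambda>n. real (Suc n) powr -(1 + \<delta>)) sums real_zeta (1 + \<delta>)"
    by (subst sums_Suc_iff) simp
  then have sums_from_2: "(\<lambda>n. real (Suc (Suc n)) powr -(1 + \<delta>)) sums (real_zeta (1 + \<delta>) - 1)"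
    by (subst sums_Suc_iff[of "\<lambda>n. real (Suc n) powr -(1 + \<delta>)"]) simp
  show "1 / \<delta> \<le> real_zeta (1 + \<delta>)"
    by (rule sums_le[OF _ telescope sums_from_1])
       (unfold u_def, intro powr_neg_step_bounds assms, simp)
  have "real_zeta (1 + \<delta>) - 1 \<le> 1 / \<delta>"
    by (rule sums_le[OF _ sums_from_2 telescope])
       (unfold u_def, intro powr_neg_step_bounds assms, simp)
  then show "real_zeta (1 + \<delta>) \<le> 1 + 1 / \<delta>" by simp
qed

lemma ln_real_zeta_asymptotics: "((\<lambda>\<delta>. ln (real_zeta (1 + \<delta>)) + ln \<delta>) \<longlongrightarrow> 0) (at_right 0)"
proof (rule tendsto_sandwich)
  have "ln (1 / \<delta>) + ln \<delta> \<le> ln (real_zeta (1 + \<delta>)) + ln \<delta> \<and>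
      ln (real_zeta (1 + \<delta>)) + ln \<delta> \<le> ln (1 + 1 / \<delta>) + ln \<delta>" if "\<delta> > 0" for \<delta>
    using real_zeta_bounds[OF that] real_zeta_pos[of "1 + \<delta>"] that by (auto intro!: ln_mono)
  then show "\<forall>\<^sub>F \<delta> in at_right 0. ln (1 / \<delta>) + ln \<delta> \<le> ln (real_zeta (1 + \<delta>)) + ln \<delta>"
    and "\<forall>\<^sub>F \<delta> in at_right 0. ln (real_zeta (1 + \<delta>)) + ln \<delta> \<le> ln (1 + 1 / \<delta>) + ln \<delta>"
    by (auto intro!: eventually_at_rightI[of 0 1])
  show "((\<lambda>\<delta>::real. ln (1 / \<delta>) + ln \<delta>) \<longlongrightarrow> 0) (at_right 0)"
    by real_asymp
  show "((\<lambda>\<delta>::real. ln (1 + 1 / \<delta>) + ln \<delta>) \<longlongrightarrow> 0) (at_right 0)"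
    by real_asymp
qed

section \<open>Mertens' third theorem\<close>

definition log_remainder :: "real \<Rightarrow> real" where
  "log_remainder x = - ln (1 - x) - x"

lemma abs_log_remainder_le:
  assumes "0 \<le> x" "x \<le> 1 / 2"
  shows "\<bar>log_remainder x\<bar> \<le> 2 * x\<^sup>2"
proof -
  have "\<bar>log_remainder x\<bar> = \<bar>ln (1 + (- x)) - (- x)\<bar>"
    by (simp add: log_remainder_def)
  also have "\<dots> \<le> 2 * (- x)\<^sup>2"
    using assms by (intro abs_ln_one_plus_x_minus_x_bound) auto
  finally show ?thesis by simp
qed

lemma abs_log_remainder_prime_powr_le:
  assumes "prime p" "s \<ge> 1"
  shows "\<bar>log_remainder (real p powr -s)\<bar> \<le> 2 * real p powr -2"
proof -
  have p_ge_2: "real p \<ge> 2"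
    using prime_ge_2_nat[OF assms(1)] by simp
  have powr_le: "real p powr -s \<le> real p powr -1"
    using p_ge_2 assms by (intro powr_mono) auto
  also have "\<dots> \<le> 1 / 2"
    using p_ge_2 by (simp add: powr_minus field_simps)
  finally have "\<bar>log_remainder (real p powr -s)\<bar> \<le> 2 * (real p powr -s)\<^sup>2"
    by (intro abs_log_remainder_le) auto
  also have "\<dots> \<le> 2 * (real p powr -1)\<^sup>2"
    using powr_le by (intro mult_left_mono power_mono) auto
  also have "(real p powr -1)\<^sup>2 = real p powr -2"
    using p_ge_2 by (simp add: powr_minus_divide power_one_over)
  finally show ?thesis .
qed

definition prime_zeta :: "real \<Rightarrow> real" where
  "prime_zeta s = (\<Sum>n. if prime n then real n powr -s else 0)"

definition prime_log_remainder :: "real \<Rightarrow> real" where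
  "prime_log_remainder s = (\<Sum>n. if prime n then log_remainder (real n powr -s) else 0)"

lemma prime_log_remainder_sums:
  assumes "s \<ge> 1"
  shows "(\<lambda>n. if prime n then log_remainder (real n powr -s) else 0) sums prime_log_remainder s"
  unfolding prime_log_remainder_def
proof (rule summable_sums, rule summable_comparison_test')
  show "summable (\<lambda>n. 2 * real n powr -2)"
    by (simp add: summable_mult summable_real_powr_iff)
  show "norm (if prime n then log_remainder (real n powr -s) else 0) \<le> 2 * real n powr -2" for n
    using abs_log_remainder_prime_powr_le[of n s] assms by simp
qed

lemma prime_log_remainder_tendsto_1:
  "((\<lambda>\<delta>. prime_log_remainder (1 + \<delta>)) \<longlongrightarrow> prime_log_remainder 1) (at_right 0)"
proof -
  let ?h = "\<lambda>n s. if prime n then log_remainder (real n powr -s) else 0"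
  have lim: "((\<lambda>\<delta>. ?h n (1 + \<delta>)) \<longlongrightarrow> ?h n 1) (at_right 0)" for n
  proof (cases "prime n")
    case True
    have "((\<lambda>\<delta>. log_remainder (real n powr -(1 + \<delta>)))
        \<longlongrightarrow> log_remainder (real n powr -(1 + 0))) (at_right 0)"
      unfolding log_remainder_def using prime_powr_less_1[OF True, of 1] prime_gt_0_nat[OF True]
      by (intro tendsto_intros) auto
    with True show ?thesis by simp
  qed simp
  have "\<forall>\<^sub>F (n :: nat, \<delta>) in at_top \<times>\<^sub>F at_right (0::real). \<delta> > 0"
    by (simp add: eventually_prod2 eventually_at_right_less)
  then have bound: "\<forall>\<^sub>F (n, \<delta>) in at_top \<times>\<^sub>F at_right 0. norm (?h n (1 + \<delta>)) \<le> 2 * real n powr -2"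
    by (rule eventually_mono)
       (auto intro: abs_log_remainder_prime_powr_le simp del: minus_add_distrib)
  have "summable (\<lambda>n. 2 * real n powr -2)"
    by (simp add: summable_mult summable_real_powr_iff)
  from tannerys_theorem[OF lim bound this] show ?thesis
    by (simp add: prime_log_remainder_def)
qed

lemma ln_real_zeta_eq:
  assumes "s > 1"
  shows "ln (real_zeta s) = prime_zeta s + prime_log_remainder s"
proof -
  have "summable (\<lambda>n. if prime n then real n powr -s else 0)"
    by (rule summable_comparison_test'[OF summable_real_zeta[OF assms]]) simp
  then have "(\<lambda>n. if prime n then real n powr -s else 0) sums prime_zeta s"
    unfolding prime_zeta_def by (rule summable_sums)
  then have "(\<lambda>n. (if prime n then real n powr -s else 0) +
      (if prime n then log_remainder (real n powr -s) else 0))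
        sums (prime_zeta s + prime_log_remainder s)"
    using assms by (intro sums_add prime_log_remainder_sums) auto
  also have "(\<lambda>n. (if prime n then real n powr -s else 0) +
      (if prime n then log_remainder (real n powr -s) else 0)) =
      (\<lambda>n. if prime n then - ln (1 - real n powr -s) else 0)"
    by (auto simp: log_remainder_def)
  finally show ?thesis
    using ln_real_zeta_sums[OF assms] by (rule sums_unique2[symmetric])
qed

lemma prime_zeta_asymptotics:
  assumes "(\<lambda>N. (\<Sum>p | prime p \<and> p \<le> N. 1 / real p) - ln (ln (real N))) \<longlonglongrightarrow> B"
  shows "((\<lambda>\<delta>. prime_zeta (1 + \<delta>) + ln \<delta>) \<longlongrightarrow> B - euler_mascheroni) (at_right 0)"
proof -
  define w where "w = (\<lambda>n::nat. if prime n then 1 / real n else 0)"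
  have "(\<Sum>p | prime p \<and> p \<le> N. 1 / real p) = (\<Sum>n=1..N. w n)" for N
    unfolding sum_primes_le_eq_sum_if w_def by (induction N) auto
  with assms have "((\<lambda>\<delta>. (\<Sum>n. w n * real n powr -\<delta>) + ln \<delta>) \<longlongrightarrow> B - euler_mascheroni) (at_right 0)"
    by (intro dirichlet_series_log_asymptotics) (auto simp: w_def)
  moreover have "w n * real n powr -\<delta> = (if prime n then real n powr -(1 + \<delta>) else 0)" for n \<delta>
    using prime_gt_0_nat[of n] by (simp add: w_def powr_diff powr_minus_divide powr_add)
  ultimately show ?thesis by (simp only: prime_zeta_def)
qed

theorem mertens_second:
  "(\<lambda>N. (\<Sum>p | prime p \<and> p \<le> N. 1 / real p) - ln (ln (real N)))
     \<longlonglongrightarrow> euler_mascheroni - prime_log_remainder 1"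
proof -
  obtain B where B_lim: "(\<lambda>N. (\<Sum>p | prime p \<and> p \<le> N. 1 / real p) - ln (ln (real N))) \<longlonglongrightarrow> B"
    using mertens_second_convergent by (auto simp: convergent_def)
  have "((\<lambda>\<delta>. ln (real_zeta (1 + \<delta>)) + ln \<delta>) \<longlongrightarrow> (B - euler_mascheroni) + prime_log_remainder 1)
      (at_right 0)"
    using tendsto_add[OF prime_zeta_asymptotics[OF B_lim] prime_log_remainder_tendsto_1]
    by (rule Lim_transform_eventually)
       (auto simp: ln_real_zeta_eq intro!: eventually_at_rightI[of 0 1])
  from tendsto_unique[OF _ this ln_real_zeta_asymptotics]
  have "B = euler_mascheroni - prime_log_remainder 1" by simp
  with B_lim show ?thesis by simp
qed

definition mertens_prod :: "nat \<Rightarrow> real" where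
  "mertens_prod N = (\<Prod>p | prime p \<and> p \<le> N. real p / (real p - 1))"

lemma mertens_prod_pos: "mertens_prod N > 0"
  unfolding mertens_prod_def by (intro prod_pos) (auto dest: prime_gt_1_nat)

lemma ln_mertens_prod:
  "ln (mertens_prod N) = (\<Sum>p | prime p \<and> p \<le> N. 1 / real p) +
     (\<Sum>n\<le>N. if prime n then log_remainder (real n powr -1) else 0)"
proof -
  have "ln (mertens_prod N) = (\<Sum>p | prime p \<and> p \<le> N. ln (real p / (real p - 1)))"
    unfolding mertens_prod_def by (rule ln_prod) (auto dest: prime_gt_1_nat)
  also have "\<dots> = (\<Sum>p | prime p \<and> p \<le> N. 1 / real p + log_remainder (real p powr -1))"
  proof (rule sum.cong)
    fix p assume "p \<in> {p. prime p \<and> p \<le> N}"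
    then have "real p > 1" using prime_gt_1_nat[of p] by simp
    then have "1 - 1 / real p = inverse (real p / (real p - 1))" by (simp add: field_simps)
    then show "ln (real p / (real p - 1)) = 1 / real p + log_remainder (real p powr -1)"
      by (simp add: log_remainder_def ln_inverse powr_minus_divide del: inverse_divide)
  qed simp
  finally show ?thesis
    by (simp only: sum.distrib sum_primes_le_eq_sum_if)
qed

theorem mertens_third: "mertens_prod \<sim>[sequentially] (\<lambda>N. exp euler_mascheroni * ln (real N))"
proof (rule asymp_equivI')
  have "(\<lambda>N. \<Sum>n\<le>N. if prime n then log_remainder (real n powr -1) else 0) \<longlonglongrightarrow> prime_log_remainder 1"
    using prime_log_remainder_sums[of 1] unfolding sums_def_le by simp
  from tendsto_add[OF mertens_second this]
  have "(\<lambda>N. ln (mertens_prod N) - ln (ln (real N))) \<longlonglongrightarrow> euler_mascheroni"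
    by (simp add: ln_mertens_prod algebra_simps)
  then have "(\<lambda>N. exp (ln (mertens_prod N) - ln (ln (real N)) - euler_mascheroni))
      \<longlonglongrightarrow> exp (euler_mascheroni - euler_mascheroni)"
    by (intro tendsto_intros)
  moreover have "\<forall>\<^sub>F N in sequentially.
      exp (ln (mertens_prod N) - ln (ln (real N)) - euler_mascheroni) =
      mertens_prod N / (exp euler_mascheroni * ln (real N))"
    using eventually_gt_at_top[of 1]
    by eventually_elim (simp add: exp_diff mertens_prod_pos mult.commute)
  ultimately show "(\<lambda>N. mertens_prod N / (exp euler_mascheroni * ln (real N))) \<longlonglongrightarrow> 1"
    by (simp add: Lim_transform_eventually)
qed

section \<open>Interpolation between consecutive primes\<close>

lemma nth_prime_less: "1 \<le> m \<Longrightarrow> m < n \<Longrightarrow> nth_prime m < nth_prime n"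
  unfolding nth_prime_def by (intro enumerate_mono primes_infinite) auto

lemma inj_on_nth_prime: "inj_on nth_prime {1..n}"
proof (rule linorder_inj_onI)
  show "nth_prime x \<noteq> nth_prime y" if "x < y" "x \<in> {1..n}" for x y
    using nth_prime_less[of x y] that by auto
qed auto

lemma primes_le_nth_prime:
  assumes "n \<ge> 1"
  shows "{p. prime p \<and> p \<le> nth_prime n} = nth_prime ` {1..n}"
proof (intro equalityI subsetI)
  fix p assume p_le: "p \<in> {p. prime p \<and> p \<le> nth_prime n}"
  then obtain k where "p = enumerate {p. prime p} k"
    using enumerate_Ex[of "{p. prime p}" p] primes_infinite by auto
  then have p_eq: "p = nth_prime (Suc k)" by (simp add: nth_prime_def)
  then have "Suc k \<le> n"
    using p_le nth_prime_less[of n "Suc k"] assms by (auto intro: leI)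
  with p_eq show "p \<in> nth_prime ` {1..n}" by auto
next
  fix p assume "p \<in> nth_prime ` {1..n}"
  then obtain k where "1 \<le> k" "k \<le> n" "p = nth_prime k" by auto
  then show "p \<in> {p. prime p \<and> p \<le> nth_prime n}"
    using nth_prime_less[of k n] by (cases "k = n") (auto simp: prime_nth_prime)
qed

lemma filterlim_nth_prime: "filterlim nth_prime at_top sequentially"
proof -
  have "n \<le> nth_prime n" for n
  proof (induction n)
    case (Suc n)
    then show ?case
      using nth_prime_less[of n "Suc n"] nth_prime_1 by (cases "n = 0") auto
  qed simp
  then show ?thesis
    by (intro filterlim_at_top_mono[OF filterlim_ident]) auto
qed

lemma filterlim_nth_prime_Suc: "filterlim (\<lambda>n. nth_prime (Suc n)) at_top sequentially"
  by (rule filterlim_compose[OF filterlim_nth_prime filterlim_Suc])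

lemma mertens_prod_nth_prime:
  assumes "n \<ge> 1"
  shows "mertens_prod (nth_prime n) = (\<Prod>i=1..n. real (nth_prime i) / (real (nth_prime i) - 1))"
  unfolding mertens_prod_def primes_le_nth_prime[OF assms]
  by (subst prod.reindex[OF inj_on_nth_prime]) simp

lemma mertens_prod_asymp_lower_prime:
  "(\<lambda>n. mertens_prod (nth_prime n)) \<sim>[sequentially]
     (\<lambda>n. exp euler_mascheroni * ln (real (nth_prime n)))"
  by (rule asymp_equiv_compose'[OF mertens_third filterlim_nth_prime])

text \<open>
  Passing to the next prime \<open>q\<close> only costs a factor of \<open>1 - 1 / q\<close>, so no bound on prime gaps is
  needed.
\<close>
lemma mertens_prod_asymp_upper_prime:
  "(\<lambda>n. mertens_prod (nth_prime n)) \<sim>[sequentially]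
     (\<lambda>n. exp euler_mascheroni * ln (real (nth_prime (Suc n))))"
proof -
  let ?q = "\<lambda>n. nth_prime (Suc n)"
  have "((\<lambda>x. 1 - 1 / real x) \<longlongrightarrow> 1) at_top"
    by real_asymp
  then have factor: "(\<lambda>n. 1 - 1 / real (?q n)) \<sim>[sequentially] (\<lambda>_. 1)"
    by (intro tendsto_imp_asymp_equiv_const filterlim_compose[OF _ filterlim_nth_prime_Suc]) auto
  have "\<forall>\<^sub>F n in sequentially.
      mertens_prod (nth_prime n) = mertens_prod (?q n) * (1 - 1 / real (?q n))"
    using eventually_ge_at_top[of 1]
  proof eventually_elim
    case (elim n)
    have "real (?q n) > 1"
      using prime_gt_1_nat[OF prime_nth_prime] by simp
    moreover have "mertens_prod (?q n) =
        mertens_prod (nth_prime n) * (real (?q n) / (real (?q n) - 1))"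
      using elim by (simp add: mertens_prod_nth_prime)
    ultimately show ?case by (simp add: divide_simps)
  qed
  then have "(\<lambda>n. mertens_prod (nth_prime n)) \<sim>[sequentially]
      (\<lambda>n. mertens_prod (?q n) * (1 - 1 / real (?q n)))"
    by (rule asymp_equiv_refl_ev)
  also have "\<dots> \<sim>[sequentially] (\<lambda>n. exp euler_mascheroni * ln (real (?q n)) * 1)"
    by (intro asymp_equiv_mult factor
        asymp_equiv_compose'[OF mertens_third filterlim_nth_prime_Suc])
  finally show ?thesis by simp
qed

lemma n_idx_spec:
  assumes "x \<ge> 2"
  shows "n_idx x \<ge> 1" "real (primorial (n_idx x)) \<le> x" "x < real (primorial (n_idx x + 1))"
  using theI'[OF ex1_primorial_index[OF assms]] unfolding n_idx_def by auto

lemma filterlim_n_idx: "filterlim n_idx at_top at_top"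
  unfolding filterlim_at_top
proof
  fix M :: nat
  show "\<forall>\<^sub>F x in at_top. M \<le> n_idx x"
    using eventually_ge_at_top[of 2] eventually_ge_at_top[of "real (primorial M)"]
  proof eventually_elim
    case (elim x)
    have "primorial M < primorial (n_idx x + 1)"
      using n_idx_spec(3)[OF elim(1)] elim(2) by linarith
    then show ?case by (simp add: strict_mono_less[OF strict_mono_primorial])
  qed
qed

lemma f_prod_eq_mertens_prod: "x \<ge> 2 \<Longrightarrow> f_prod x = mertens_prod (nth_prime (n_idx x))"
  unfolding f_prod_def by (rule mertens_prod_nth_prime[OF n_idx_spec(1), symmetric])

lemma y_interp_bounds:
  assumes "x \<ge> 2"
  shows "real (nth_prime (n_idx x)) \<le> y_interp x" "y_interp x \<le> real (nth_prime (Suc (n_idx x)))"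
proof -
  define p q r where "p = real (nth_prime (n_idx x))" and "q = real (nth_prime (Suc (n_idx x)))"
    and "r = r_frac x"
  note n_idx = n_idx_spec[OF assms]
  have "p > 0" by (simp add: p_def prime_gt_0_nat prime_nth_prime)
  then have y_eq: "y_interp x = p + (q - p) * r"
    unfolding y_interp_def by (simp add: p_def q_def r_def field_simps)
  have "p \<le> q" using nth_prime_less[of "n_idx x" "Suc (n_idx x)"] n_idx by (simp add: p_def q_def)
  moreover have "0 \<le> r" "r \<le> 1" using n_idx by (auto simp: r_def r_frac_def)
  ultimately have "0 \<le> (q - p) * r" "(q - p) * r \<le> (q - p) * 1"
    using mult_left_mono[of r 1 "q - p"] by simp_all
  then show "real (nth_prime (n_idx x)) \<le> y_interp x"
    "y_interp x \<le> real (nth_prime (Suc (n_idx x)))"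
    unfolding y_eq p_def [symmetric] q_def [symmetric] by simp_all
qed

lemma g_circ_bounds:
  assumes "x \<ge> 2"
  shows "0 < g_circ x"
    and "g_circ x \<in> {exp euler_mascheroni * ln (real (nth_prime (n_idx x)))..
                      exp euler_mascheroni * ln (real (nth_prime (Suc (n_idx x))))}"
proof -
  have "real (nth_prime (n_idx x)) > 1"
    using prime_gt_1_nat[OF prime_nth_prime] by simp
  with y_interp_bounds[OF assms]
  show "0 < g_circ x"
    and "g_circ x \<in> {exp euler_mascheroni * ln (real (nth_prime (n_idx x)))..
                      exp euler_mascheroni * ln (real (nth_prime (Suc (n_idx x))))}"
    by (auto simp: g_circ_def)
qed

theorem theorem3p4:
  shows "((\<lambda>x::real. f_prod x / g_circ x) \<longlongrightarrow> 1) at_top"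
proof -
  define P where "P = (\<lambda>x. mertens_prod (nth_prime (n_idx x)))"
  have "P \<sim>[at_top] (\<lambda>x. exp euler_mascheroni * ln (real (nth_prime (n_idx x))))"
    unfolding P_def
    by (rule asymp_equiv_compose'[OF mertens_prod_asymp_lower_prime filterlim_n_idx])
  moreover have "P \<sim>[at_top] (\<lambda>x. exp euler_mascheroni * ln (real (nth_prime (Suc (n_idx x)))))"
    unfolding P_def
    by (rule asymp_equiv_compose'[OF mertens_prod_asymp_upper_prime filterlim_n_idx])
  ultimately have "P \<sim>[at_top] g_circ"
    by (rule asymp_equiv_sandwich_real')
       (rule eventually_mono[OF eventually_ge_at_top g_circ_bounds(2)])
  then have "((\<lambda>x. P x / g_circ x) \<longlongrightarrow> 1) at_top"
    by (rule asymp_equivD_strong, intro eventually_mono[OF eventually_ge_at_top[of 2]])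
       (use g_circ_bounds(1) in fastforce)
  moreover have "\<forall>\<^sub>F x in at_top. P x / g_circ x = f_prod x / g_circ x"
    using eventually_ge_at_top[of 2] by eventually_elim (simp add: P_def f_prod_eq_mertens_prod)
  ultimately show ?thesis by (rule Lim_transform_eventually)
qed

end
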